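(* Let $n\in\mathbb N$, $a\in\mathbb C$, $a\ne 0$, $A,Q,S(0)\in\mathbb C^{n\times n}$ and $f_1,f_2$ be such that $$\mathrm i a\in\mathbb R,\quad \mathrm i A,\ \mathrm i Q,\ S(0)\in\mathbb R^{n\times n},\quad S(0)=S(0)^*,\quad f_1,f_2\in\mathbb R^{n\times 1},$$ and assume that $AQ=QA$ and $Q^2=A^2+|a|^2I_n$. Put $f_3=\frac{\mathrm i}{\bar a}(Q+A)f_1$, $f_4=-\frac{\mathrm i}{\bar a}(Q-A)f_2$, $$\Lambda_1(x)=e^{\mathrm i xQ}f_1+e^{-\mathrm i xQ}f_2,\qquad \Lambda_2(x)=e^{\mathrm i xQ}f_3+e^{-\mathrm i xQ}f_4,\qquad \Pi(x)=\begin{bmatrix}\Lambda_1(x)&\Lambda_2(x)\end{bmatrix},$$ assume that $AS(0)-S(0)A^*=\mathrm i\,\Pi(0)\Pi(0)^*$, and let $S(x)=S(0)+\int_0^x\Pi(r)\sigma_3\Pi(r)^*dr$. Then, at the points $x$ where $S(x)$ is invertible, the matrix function $\psi(x,\xi)=\Pi(x)^*S(x)^{-1}e^{-\xi A}$ satisfies the Dirac--Weyl system $$\psi_x=\mathrm i\sigma_3\big(-\psi_\xi+\mathrm i\,\omega(x)\sigma_2\psi\big),\qquad \omega(x)=-\mathrm i\big(a+2\Lambda_1(x)^*S(x)^{-1}\Lambda_2(x)\big),$$ where $\omega(x)=\overline{\omega(x)}$.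
   Context: Here $\mathrm i^2=-1$, $A^*$ is the conjugate transpose of $A$, $x,\xi$ are real variables, $\psi_x=\frac{\partial}{\partial x}\psi$, $\psi_\xi=\frac{\partial}{\partial\xi}\psi$, and $\sigma_2=\begin{bmatrix}0&-\mathrm i\\ \mathrm i&0\end{bmatrix}$, $\sigma_3=\begin{bmatrix}1&0\\0&-1\end{bmatrix}$ are Pauli matrices. A Dirac--Weyl system of this form is by definition required to have a real-valued function $\omega$. *)

theory Defs
  imports "HOL-Analysis.Analysis"
begin

(* Complex scalar multiple of a matrix; the library operator *s only scales vectors, and the
   componentwise product on the vec type is not matrix multiplication. *)
definition cscale :: "complex \<Rightarrow> complex^'m^'n \<Rightarrow> complex^'m^'n" (infixl "*k" 75)
  where "c *k A = (\<chi> i j. c * A $ i $ j)"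

definition ctranspose :: "complex^'m^'n \<Rightarrow> complex^'n^'m"
  where "ctranspose A = (\<chi> i j. cnj (A $ j $ i))"

(* The scalar u^* v for column vectors u, v: conjugate-linear in the first argument. *)
definition cdot :: "complex^'n \<Rightarrow> complex^'n \<Rightarrow> complex"
  where "cdot u v = (\<Sum>i\<in>UNIV. cnj (u $ i) * v $ i)"

definition real_vector :: "complex^'n \<Rightarrow> bool"
  where "real_vector v \<longleftrightarrow> (\<forall>i. v $ i \<in> \<real>)"

definition real_matrix :: "complex^'m^'n \<Rightarrow> bool"
  where "real_matrix A \<longleftrightarrow> (\<forall>i j. A $ i $ j \<in> \<real>)"

(* The library exp is not available on matrices, whose type carries no normed algebra
   structure for **, so the exponential series is written out; ((**) A ^^ k) (mat 1) is
   the k-th matrix power of A. *)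
definition mat_exp :: "complex^'n^'n \<Rightarrow> complex^'n^'n"
  where "mat_exp A = (\<Sum>k. (1 / fact k) *\<^sub>R ((**) A ^^ k) (mat 1))"

definition two_columns :: "complex^'n \<Rightarrow> complex^'n \<Rightarrow> complex^2^'n"
  where "two_columns u v = (\<chi> i. vector [u $ i, v $ i])"

definition pauli2 :: "complex^2^2"
  where "pauli2 = vector [vector [0, - \<i>], vector [\<i>, 0]]"

definition pauli3 :: "complex^2^2"
  where "pauli3 = vector [vector [1, 0], vector [0, - 1]]"

end

theory Submission
  imports Defs
begin

text \<open>
  Differentiating the exponentials shows that \<open>P' = - \<i> A P \<sigma>\<^sub>3 - a P \<sigma>\<^sub>1\<close>; together with
  \<open>S' = P \<sigma>\<^sub>3 P\<^sup>*\<close> this makes the defect of \<open>A S - S A\<^sup>* = \<i> P P\<^sup>*\<close> constant in \<open>x\<close>, so the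
  identity propagates from \<open>x = 0\<close>. It allows \<open>A\<^sup>*\<close> to be moved across \<open>S\<inverse>\<close> in the derivative of
  \<open>R = P\<^sup>* S\<inverse>\<close>, which becomes \<open>\<i> \<sigma>\<^sub>3 R A + (a \<sigma>\<^sub>1 + \<sigma>\<^sub>3 X - X \<sigma>\<^sub>3) R\<close> with \<open>X = R P\<close>.
  Here \<open>X\<close> is Hermitian, and \<open>X\<^sub>1\<^sub>2\<close> is purely imaginary because \<open>\<Lambda>\<^sub>1\<close>, \<open>\<i> \<Lambda>\<^sub>2\<close> and \<open>S\<close> are real.
  Hence the commutator is \<open>2 X\<^sub>1\<^sub>2 \<sigma>\<^sub>1\<close>, and \<open>\<sigma>\<^sub>3 \<sigma>\<^sub>2 = - \<i> \<sigma>\<^sub>1\<close> turns this into the stated system.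
\<close>

section \<open>Linear structure of matrix products, scalar multiples and adjoints\<close>

lemma cscale_nth [simp]: "(c *k A) $ i $ j = c * A $ i $ j"
  by (simp add: cscale_def)

lemma ctranspose_nth [simp]: "ctranspose A $ i $ j = cnj (A $ j $ i)"
  by (simp add: ctranspose_def)

lemma cscale_matrix_mult: "(c *k A) ** B = c *k (A ** B)"
  by (simp add: vec_eq_iff matrix_matrix_mult_def sum_distrib_left mult.assoc)

lemma matrix_mult_cscale: "A ** (c *k B) = c *k (A ** B)"
  by (simp add: vec_eq_iff matrix_matrix_mult_def sum_distrib_left mult_ac)

lemma cscale_cscale: "c *k (d *k A) = (c * d) *k A"
  by (simp add: vec_eq_iff)

lemma bounded_linear_cscale: "bounded_linear ((*k) c :: complex^'n^'m \<Rightarrow> complex^'n^'m)"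
  unfolding linear_conv_bounded_linear [symmetric]
  by (auto intro!: linearI simp: vec_eq_iff distrib_left)

lemma cscale_matrix_vector_mult: "(c *k A) *v v = c *s (A *v v)"
  by (simp add: vec_eq_iff matrix_vector_mult_def sum_distrib_left mult.assoc)

lemma matrix_vector_mult_scalar: "A *v (c *s v) = c *s (A *v (v :: complex^'n))"
  by (simp add: vec_eq_iff matrix_vector_mult_def sum_distrib_left mult_ac)

text \<open>In finite dimension bilinearity already gives boundedness; the interpretation that
  follows then provides limits, termwise sums and the product rule for \<open>**\<close>.\<close>

lemma bounded_bilinear_matrix_mult:
  "bounded_bilinear ((**) :: complex^'n^'m \<Rightarrow> complex^'p^'n \<Rightarrow> complex^'p^'m)"
  unfolding bilinear_conv_bounded_bilinear [symmetric] bilinear_def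
  by (auto intro!: linearI simp: matrix_add_ldistrib vec_eq_iff matrix_matrix_mult_def
      sum.distrib sum_distrib_left scaleR_sum_right distrib_right distrib_left)

interpretation matrix_mult: bounded_bilinear
  "(**) :: complex^'n^'m \<Rightarrow> complex^'p^'n \<Rightarrow> complex^'p^'m"
  by (rule bounded_bilinear_matrix_mult)

lemma bounded_bilinear_matrix_vector_mult:
  "bounded_bilinear ((*v) :: complex^'n^'m \<Rightarrow> complex^'n \<Rightarrow> complex^'m)"
  unfolding bilinear_conv_bounded_bilinear [symmetric] bilinear_def
  by (auto intro!: linearI simp: vec_eq_iff matrix_vector_mult_def
      sum.distrib sum_distrib_left scaleR_sum_right distrib_right distrib_left)

interpretation matrix_vector_mult: bounded_bilinear
  "(*v) :: complex^'n^'m \<Rightarrow> complex^'n \<Rightarrow> complex^'m"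
  by (rule bounded_bilinear_matrix_vector_mult)

lemma bounded_linear_ctranspose: "bounded_linear (ctranspose :: complex^'n^'m \<Rightarrow> complex^'m^'n)"
  unfolding linear_conv_bounded_linear [symmetric]
  by (auto intro!: linearI simp: vec_eq_iff)

lemma ctranspose_minus: "ctranspose (- A) = - ctranspose A"
  by (simp add: vec_eq_iff)

lemma ctranspose_diff: "ctranspose (A - B) = ctranspose A - ctranspose B"
  by (simp add: vec_eq_iff)

lemma ctranspose_matrix_mult: "ctranspose (A ** B) = ctranspose B ** ctranspose A"
  by (simp add: vec_eq_iff matrix_matrix_mult_def mult.commute)

lemma ctranspose_cscale: "ctranspose (c *k A) = cnj c *k ctranspose A"
  by (simp add: vec_eq_iff)

lemma ctranspose_ctranspose: "ctranspose (ctranspose A) = A"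
  by (simp add: vec_eq_iff)

lemma ctranspose_mat_1: "ctranspose (mat 1) = mat 1"
  by (simp add: vec_eq_iff mat_def)

section \<open>Derivatives as limits of difference quotients\<close>

lemma has_vector_derivative_iff_quotient:
  "(f has_vector_derivative D) (at x) \<longleftrightarrow>
    ((\<lambda>y. (1 / (y - x)) *\<^sub>R (f y - f x)) \<longlongrightarrow> D) (at (x :: real))"
proof -
  have "(f has_vector_derivative D) (at x) \<longleftrightarrow>
      ((\<lambda>y. norm ((1 / norm (y - x)) *\<^sub>R (f y - (f x + (y - x) *\<^sub>R D)))) \<longlongrightarrow> 0) (at x)"
    unfolding tendsto_norm_zero_iff has_vector_derivative_def has_derivative_within
    by (simp add: bounded_linear_scaleR_left)
  also have "\<dots> \<longleftrightarrow> ((\<lambda>y. norm ((1 / (y - x)) *\<^sub>R (f y - f x) - D)) \<longlongrightarrow> 0) (at x)"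
  proof (intro filterlim_cong refl)
    \<comment> \<open>Dividing the remainder by the signed increment instead of its absolute value
      changes at most a sign, which the norm ignores.\<close>
    have "norm ((1 / norm (y - x)) *\<^sub>R (f y - (f x + (y - x) *\<^sub>R D)))
        = norm ((1 / (y - x)) *\<^sub>R (f y - f x) - D)" if "y \<noteq> x" for y
    proof -
      have "(1 / (y - x)) *\<^sub>R (f y - f x) - D = (1 / (y - x)) *\<^sub>R (f y - (f x + (y - x) *\<^sub>R D))"
        using that by (simp add: scaleR_right_distrib scaleR_right_diff_distrib)
      then show ?thesis by simp
    qed
    then show "\<forall>\<^sub>F y in at x. norm ((1 / norm (y - x)) *\<^sub>R (f y - (f x + (y - x) *\<^sub>R D)))
        = norm ((1 / (y - x)) *\<^sub>R (f y - f x) - D)"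
      by (auto simp: eventually_at_filter simp del: norm_scaleR)
  qed
  also have "\<dots> \<longleftrightarrow> ((\<lambda>y. (1 / (y - x)) *\<^sub>R (f y - f x)) \<longlongrightarrow> D) (at x)"
    unfolding tendsto_norm_zero_iff by (rule LIM_zero_iff)
  finally show ?thesis .
qed

text \<open>Limits in a product are taken componentwise, hence so are limits of quotients. Two
  applications reduce a matrix function to its scalar entries.\<close>

lemma has_vector_derivative_vecI:
  fixes f :: "real \<Rightarrow> ('a::real_normed_vector)^'n"
  assumes "\<And>i. ((\<lambda>t. f t $ i) has_vector_derivative D $ i) (at x)"
  shows "(f has_vector_derivative D) (at x)"
  using assms unfolding has_vector_derivative_iff_quotient
  by (intro vec_tendstoI) simp

section \<open>The matrix exponential: convergence, commutation, derivative\<close>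

abbreviation mat_pow :: "complex^'n^'n \<Rightarrow> nat \<Rightarrow> complex^'n^'n"
  where "mat_pow A k \<equiv> ((**) A ^^ k) (mat 1)"

text \<open>The matrix norm is submultiplicative up to a constant \<open>K\<close>, so the series is
  dominated by a multiple of the scalar exponential series at \<open>norm A * K\<close>.\<close>

lemma mat_exp_sums:
  fixes A :: "complex^'n^'n"
  shows "(\<lambda>k. (1 / fact k) *\<^sub>R mat_pow A k) sums mat_exp A"
proof -
  obtain K where K: "K \<ge> 0" "\<And>(B :: complex^'n^'n) (C :: complex^'n^'n). norm (B ** C) \<le> norm B * norm C * K"
    using matrix_mult.nonneg_bounded by blast
  have pow: "norm (mat_pow A k) \<le> (norm A * K) ^ k * norm (mat 1 :: complex^'n^'n)" for k
  proof (induction k)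
    case (Suc k)
    have "norm (mat_pow A (Suc k)) \<le> norm A * norm (mat_pow A k) * K"
      using K(2) [of A "mat_pow A k"] by simp
    also have "\<dots> \<le> norm A * ((norm A * K) ^ k * norm (mat 1 :: complex^'n^'n)) * K"
      using Suc K(1) by (intro mult_left_mono mult_right_mono) auto
    finally show ?case by (simp add: mult_ac)
  qed simp
  have "summable (\<lambda>k. (norm A * K) ^ k /\<^sub>R fact k * norm (mat 1 :: complex^'n^'n))"
    by (intro summable_mult2 summable_exp_generic)
  then have "summable (\<lambda>k. (1 / fact k) *\<^sub>R mat_pow A k)"
    by (rule summable_comparison_test')
      (use pow in \<open>auto simp: divide_simps\<close>)
  then show ?thesis
    unfolding mat_exp_def by (rule summable_sums)
qed

lemma mat_pow_cscale: "mat_pow (c *k A) k = c ^ k *k mat_pow A k"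
proof (induction k)
  case (Suc k)
  have "mat_pow (c *k A) (Suc k) = (c *k A) ** mat_pow (c *k A) k"
    by simp
  also have "\<dots> = c ^ Suc k *k mat_pow A (Suc k)"
    by (simp only: Suc) (simp add: cscale_matrix_mult matrix_mult_cscale cscale_cscale mult.commute)
  finally show ?case .
qed (simp add: vec_eq_iff)

text \<open>Commutation passes to all powers by induction. Multiplication by \<open>C\<close> on
  either side is continuous, so both products are sums of the same series.\<close>

lemma mat_exp_commute:
  assumes "C ** A = A ** C"
  shows "C ** mat_exp A = mat_exp A ** C"
proof -
  have "C ** mat_pow A k = mat_pow A k ** C" for k
  proof (induction k)
    case (Suc k)
    have "C ** mat_pow A (Suc k) = A ** (C ** mat_pow A k)"
      by (simp add: matrix_mul_assoc) (simp add: assms)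
    also have "\<dots> = mat_pow A (Suc k) ** C"
      by (simp only: Suc) (simp add: matrix_mul_assoc)
    finally show ?case .
  qed simp
  then have eq: "C ** ((1 / fact k) *\<^sub>R mat_pow A k) = ((1 / fact k) *\<^sub>R mat_pow A k) ** C" for k
    by (simp only: matrix_mult.scaleR_left matrix_mult.scaleR_right)
  have "(\<lambda>k. C ** ((1 / fact k) *\<^sub>R mat_pow A k)) sums (C ** mat_exp A)"
    by (intro matrix_mult.bounded_linear_right [THEN bounded_linear.sums] mat_exp_sums)
  moreover have "(\<lambda>k. C ** ((1 / fact k) *\<^sub>R mat_pow A k)) sums (mat_exp A ** C)"
    unfolding eq by (intro matrix_mult.bounded_linear_left [THEN bounded_linear.sums] mat_exp_sums)
  ultimately show ?thesis
    by (rule sums_unique2)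
qed

text \<open>Each entry of the exponential of \<open>z *k B\<close> is an everywhere convergent power
  series in complex \<open>z\<close>, which may be differentiated termwise; the claim is its
  restriction to the real axis.\<close>

lemma mat_exp_has_vector_derivative:
  "((\<lambda>t. mat_exp (complex_of_real t *k B)) has_vector_derivative
     B ** mat_exp (complex_of_real x *k B)) (at x)"
proof (intro has_vector_derivative_vecI)
  fix i j
  define c where "c k = mat_pow B k $ i $ j / fact k" for k
  have F: "(\<lambda>k. c k * z ^ k) sums mat_exp (z *k B) $ i $ j" for z
    using sums_vec_nth [OF sums_vec_nth [OF mat_exp_sums [of "z *k B"]], of i j]
    by (simp add: mat_pow_cscale c_def scaleR_conv_of_real [where 'a = complex] mult_ac)
  \<comment> \<open>The factor k+1 from differentiation turns (k+1)! into k!, leaving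
    \<open>mat_pow B (Suc k)\<close> over k!, that is, the series multiplied by
    \<open>B\<close>.\<close>
  have F': "(\<lambda>k. diffs c k * z ^ k) sums (B ** mat_exp (z *k B)) $ i $ j" for z
  proof -
    have "(\<lambda>k. B ** ((1 / fact k) *\<^sub>R mat_pow (z *k B) k)) sums (B ** mat_exp (z *k B))"
      by (intro matrix_mult.bounded_linear_right [THEN bounded_linear.sums] mat_exp_sums)
    from sums_vec_nth [OF sums_vec_nth [OF this], of i j]
    have "(\<lambda>k. (1 / fact k) *\<^sub>R (z ^ k * mat_pow B (Suc k) $ i $ j)) sums
        (B ** mat_exp (z *k B)) $ i $ j"
      by (simp add: mat_pow_cscale matrix_mult_cscale matrix_mult.scaleR_right)
    moreover have "diffs c k * z ^ k = (1 / fact k) *\<^sub>R (z ^ k * mat_pow B (Suc k) $ i $ j)" for k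
      by (simp add: diffs_def c_def scaleR_conv_of_real [where 'a = complex]
          del: funpow.simps of_nat_Suc)
    ultimately show ?thesis
      by (simp only:)
  qed
  have "((\<lambda>z. mat_exp (z *k B) $ i $ j) has_field_derivative (B ** mat_exp (z *k B)) $ i $ j) (at z)" for z
    using termdiffs_strong_converges_everywhere [of c z] F F' by (simp add: sums_iff)
  then show "((\<lambda>t. mat_exp (complex_of_real t *k B) $ i $ j) has_vector_derivative
      (B ** mat_exp (complex_of_real x *k B)) $ i $ j) (at x)"
    by (rule has_vector_derivative_real_field)
qed

section \<open>Matrices and vectors with real entries\<close>

lemma real_matrix_mult: "real_matrix A \<Longrightarrow> real_matrix B \<Longrightarrow> real_matrix (A ** B)"
  by (auto simp: real_matrix_def matrix_matrix_mult_def)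

lemma real_matrix_vector_mult: "real_matrix A \<Longrightarrow> real_vector v \<Longrightarrow> real_vector (A *v v)"
  by (auto simp: real_matrix_def real_vector_def matrix_vector_mult_def)

lemma cdot_in_Reals: "real_vector u \<Longrightarrow> real_vector v \<Longrightarrow> cdot u v \<in> \<real>"
  unfolding cdot_def real_vector_def by (intro sum_in_Reals Reals_mult) (simp_all add: Reals_cnj_iff)

lemma real_matrix_mat_exp:
  assumes "real_matrix A"
  shows "real_matrix (mat_exp A)"
  unfolding real_matrix_def
proof (intro allI)
  fix i j
  have "real_matrix (mat_pow A k)" for k
  proof (induction k)
    case 0
    show ?case by (simp add: real_matrix_def mat_def)
  next
    case (Suc k)
    with assms show ?case by (simp add: real_matrix_mult)
  qed
  then have "cnj ((1 / fact k) *\<^sub>R mat_pow A k $ i $ j) = (1 / fact k) *\<^sub>R mat_pow A k $ i $ j" for k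
    by (simp add: real_matrix_def Reals_cnj_iff)
  moreover have s: "(\<lambda>k. (1 / fact k) *\<^sub>R mat_pow A k $ i $ j) sums mat_exp A $ i $ j"
    using sums_vec_nth [OF sums_vec_nth [OF mat_exp_sums]] by simp
  ultimately have "(\<lambda>k. (1 / fact k) *\<^sub>R mat_pow A k $ i $ j) sums cnj (mat_exp A $ i $ j)"
    using sums_cnj [of "\<lambda>k. (1 / fact k) *\<^sub>R mat_pow A k $ i $ j" "mat_exp A $ i $ j"] by (simp only:)
  then show "mat_exp A $ i $ j \<in> \<real>"
    unfolding Reals_cnj_iff by (rule sums_unique2 [OF _ s])
qed

section \<open>Inverses of matrices: continuity, derivative, adjoint, realness\<close>

lemma
  assumes "invertible A"
  shows matrix_inv_right: "A ** matrix_inv A = mat 1"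
    and matrix_inv_left: "matrix_inv A ** A = mat 1"
  using someI_ex [OF assms [unfolded invertible_def]] by (auto simp: matrix_inv_def)

text \<open>Cramer's rule applied to each column of the identity. Having the entries as quotients of
  determinants makes continuity of inversion a matter of polynomials.\<close>

lemma matrix_inv_cofactor:
  fixes A :: "'a::field^'n^'n"
  assumes "det A \<noteq> 0"
  shows "matrix_inv A = (\<chi> k l. det (\<chi> i j. if j = k then mat 1 $ i $ l else A $ i $ j) / det A)"
proof -
  have "A *v column l (matrix_inv A) = column l (mat 1)" for l
    using matrix_inv_right [of A] assms
    by (simp add: invertible_det_nz vec_eq_iff matrix_matrix_mult_def matrix_vector_mult_def column_def)
  from this [unfolded cramer [OF assms]] show ?thesis
    by (simp add: vec_eq_iff column_def cong: if_cong)
qed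

lemma tendsto_det:
  fixes f :: "'b \<Rightarrow> 'a::real_normed_field^'n^'n"
  assumes "(f \<longlongrightarrow> A) F"
  shows "((\<lambda>t. det (f t)) \<longlongrightarrow> det A) F"
  unfolding det_def by (intro tendsto_intros assms)

lemma tendsto_matrix_inv:
  fixes f :: "'b \<Rightarrow> 'a::real_normed_field^'n^'n"
  assumes f: "(f \<longlongrightarrow> A) F" and "invertible A"
  shows "((\<lambda>t. matrix_inv (f t)) \<longlongrightarrow> matrix_inv A) F"
proof -
  have nz: "det A \<noteq> 0"
    using assms by (simp add: invertible_det_nz)
  have ev: "\<forall>\<^sub>F t in F. det (f t) \<noteq> 0"
    using tendsto_imp_eventually_ne [OF tendsto_det [OF f] nz] .
  have "((\<lambda>t. \<chi> k l. det (\<chi> i j. if j = k then mat 1 $ i $ l else f t $ i $ j) / det (f t))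
      \<longlongrightarrow> (\<chi> k l. det (\<chi> i j. if j = k then mat 1 $ i $ l else A $ i $ j) / det A)) F"
    by (intro tendsto_intros tendsto_det nz) (auto intro!: tendsto_intros f)
  then show ?thesis
    unfolding matrix_inv_cofactor [OF nz]
    by (rule Lim_transform_eventually) (use ev in eventually_elim, simp add: matrix_inv_cofactor)
qed

text \<open>Invertibility is an open condition, so it holds near \<open>x\<close>. There the
  difference of inverses is \<open>- (matrix_inv (S t) ** (S t - S x) ** matrix_inv (S x))\<close>;
  divide by \<open>t - x\<close> and use continuity of inversion in the left factor.\<close>

lemma matrix_inv_has_vector_derivative:
  fixes S :: "real \<Rightarrow> complex^'n^'n"
  assumes S: "(S has_vector_derivative D) (at x)" and inv: "invertible (S x)"
  shows "((\<lambda>t. matrix_inv (S t)) has_vector_derivative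
           - (matrix_inv (S x) ** D ** matrix_inv (S x))) (at x)"
proof -
  have lim: "(S \<longlongrightarrow> S x) (at x)"
    using has_vector_derivative_continuous [OF S] by (simp add: continuous_within)
  have "\<forall>\<^sub>F t in at x. det (S t) \<noteq> 0"
    using tendsto_imp_eventually_ne [OF tendsto_det [OF lim]] inv by (simp add: invertible_det_nz)
  then have ev: "\<forall>\<^sub>F t in at x. - (matrix_inv (S t) ** ((1 / (t - x)) *\<^sub>R (S t - S x)) ** matrix_inv (S x))
      = (1 / (t - x)) *\<^sub>R (matrix_inv (S t) - matrix_inv (S x))"
  proof eventually_elim
    case (elim t)
    then have "invertible (S t)" by (simp add: invertible_det_nz)
    then show ?case
      using inv by (simp add: matrix_mult.diff_left matrix_mult.diff_right matrix_mult.scaleR_left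
          matrix_mult.scaleR_right matrix_inv_left matrix_inv_right flip: matrix_mul_assoc scaleR_minus_right)
  qed
  show ?thesis
    unfolding has_vector_derivative_iff_quotient
    by (rule Lim_transform_eventually [OF _ ev])
      (intro tendsto_minus matrix_mult.tendsto tendsto_const tendsto_matrix_inv lim inv
        S [unfolded has_vector_derivative_iff_quotient])
qed

lemma matrix_inv_eqI:
  fixes A B :: "complex^'n^'n"
  assumes "invertible A" "B ** A = mat 1"
  shows "matrix_inv A = B"
  by (metis assms matrix_inv_right matrix_mul_assoc matrix_mul_lid matrix_mul_rid)

lemma ctranspose_matrix_inv:
  fixes A :: "complex^'n^'n"
  assumes "invertible A"
  shows "ctranspose (matrix_inv A) = matrix_inv (ctranspose A)"
proof (rule matrix_inv_eqI [symmetric])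
  show "ctranspose (matrix_inv A) ** ctranspose A = mat 1"
    by (simp add: assms matrix_inv_right ctranspose_mat_1 flip: ctranspose_matrix_mult)
  then show "invertible (ctranspose A)"
    using invertible_left_inverse by blast
qed

text \<open>Conjugating the entries of the inverse of a real matrix gives another left inverse, and
  the inverse is unique.\<close>

lemma real_matrix_matrix_inv:
  fixes A :: "complex^'n^'n"
  assumes "invertible A" "real_matrix A"
  shows "real_matrix (matrix_inv A)"
proof -
  have "(\<chi> i j. cnj (matrix_inv A $ i $ j)) ** A = mat 1"
  proof -
    have "((\<chi> i j. cnj (matrix_inv A $ i $ j)) ** A) $ i $ j = cnj ((matrix_inv A ** A) $ i $ j)" for i j
      using assms(2) by (simp add: matrix_matrix_mult_def real_matrix_def Reals_cnj_iff)
    then show ?thesis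
      by (simp add: matrix_inv_left assms vec_eq_iff mat_def)
  qed
  from matrix_inv_eqI [OF assms(1) this] show ?thesis
    by (simp add: real_matrix_def Reals_cnj_iff vec_eq_iff)
qed

section \<open>Integration and constancy on the real line\<close>

lemma interval_integral_has_vector_derivative:
  fixes f :: "real \<Rightarrow> 'a::euclidean_space"
  assumes "continuous_on UNIV f"
  shows "((\<lambda>u. LBINT y=0..u. f y) has_vector_derivative f x) (at x)"
proof -
  \<comment> \<open>This interval contains 0 and has \<open>x\<close> in its interior, whatever the
    sign of \<open>x\<close>, so the derivative within it is the full derivative.\<close>
  let ?I = "{- \<bar>x\<bar> - 1..\<bar>x\<bar> + 1}"
  have "((\<lambda>u. LBINT y=ereal 0..u. f y) has_vector_derivative f x) (at x within ?I)"
    by (rule interval_integral_FTC2) (auto intro: continuous_on_subset [OF assms])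
  moreover have "at x within ?I = at x"
    by (rule at_within_Icc_at) auto
  ultimately show ?thesis
    by (simp add: zero_ereal_def)
qed

lemma has_vector_derivative_zero_imp_eq:
  fixes f :: "real \<Rightarrow> 'a::real_normed_vector"
  assumes "\<And>t. (f has_vector_derivative 0) (at t)"
  shows "f x = f y"
  using has_derivative_zero_unique [of UNIV f x y] assms by (simp add: has_vector_derivative_def)

section \<open>Pauli matrices and matrices with two columns\<close>

definition pauli1 :: "complex^2^2"
  where "pauli1 = vector [vector [0, 1], vector [1, 0]]"

lemma two_columns_nth [simp]:
  "two_columns u v $ i $ 1 = u $ i" "two_columns u v $ i $ 2 = v $ i"
  by (simp_all add: two_columns_def)

lemma matrix_mult_two_columns: "A ** two_columns u v = two_columns (A *v u) (A *v v)"
  by (simp add: vec_eq_iff forall_2 matrix_matrix_mult_def matrix_vector_mult_def)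

lemma two_columns_mult_pauli:
  "two_columns u v ** pauli1 = two_columns v u"
  "two_columns u v ** pauli3 = two_columns u (- v)"
  by (simp_all add: vec_eq_iff forall_2 matrix_matrix_mult_def sum_2 pauli1_def pauli3_def)

lemma two_columns_has_vector_derivative:
  assumes "(f has_vector_derivative f') (at x)" "(g has_vector_derivative g') (at x)"
  shows "((\<lambda>t. two_columns (f t) (g t)) has_vector_derivative two_columns f' g') (at x)"
proof (intro has_vector_derivative_vecI)
  fix i and j :: 2
  show "((\<lambda>t. two_columns (f t) (g t) $ i $ j) has_vector_derivative two_columns f' g' $ i $ j) (at x)"
    using bounded_linear.has_vector_derivative [OF bounded_linear_vec_nth assms(1), of i]
      bounded_linear.has_vector_derivative [OF bounded_linear_vec_nth assms(2), of i]
      exhaust_2 [of j] by auto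
qed

lemma ctranspose_pauli [simp]: "ctranspose pauli1 = pauli1" "ctranspose pauli3 = pauli3"
  by (simp_all add: vec_eq_iff forall_2 pauli1_def pauli3_def)

lemma pauli3_mult_pauli2: "pauli3 ** pauli2 = - \<i> *k pauli1"
  by (simp add: vec_eq_iff forall_2 matrix_matrix_mult_def sum_2 pauli1_def pauli2_def pauli3_def)

text \<open>The commutator with \<open>pauli3\<close> kills the diagonal and doubles the
  off-diagonal entries with opposite signs; the hypothesis makes the two results equal.\<close>

lemma pauli3_commutator:
  assumes "X $ 2 $ 1 = - X $ 1 $ 2"
  shows "pauli3 ** X - X ** pauli3 = (2 * X $ 1 $ 2) *k pauli1"
  using assms
  by (simp add: vec_eq_iff forall_2 matrix_matrix_mult_def sum_2 pauli1_def pauli3_def)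

lemma cscale_add: "c *k (A + B) = c *k A + c *k B"
  and cscale_diff: "c *k (A - B) = c *k A - c *k B"
  and cscale_minus: "c *k (- A) = - (c *k A)"
  and cscale_minus_left: "(- c) *k A = - (c *k A)"
  and cscale_one: "1 *k A = A"
  by (simp_all add: vec_eq_iff algebra_simps)

text \<open>Expands into sums of scalar multiples of left-associated products, so that identities
  reduce to additive cancellation.\<close>

lemmas matrix_algebra = matrix_mult.add_left matrix_mult.add_right matrix_mult.diff_left
  matrix_mult.diff_right matrix_mult.minus_left matrix_mult.minus_right cscale_matrix_mult
  matrix_mult_cscale cscale_cscale cscale_add cscale_diff cscale_minus cscale_minus_left
  cscale_one matrix_mul_assoc

text \<open>Everything is assumed at the single point \<open>x\<close>. In the commutator, one term
  arises from moving \<open>ctranspose A\<close> across the inverse of \<open>S x\<close>, the other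
  from differentiating that inverse.\<close>

lemma darboux_has_vector_derivative:
  fixes P :: "real \<Rightarrow> complex^2^'n" and S :: "real \<Rightarrow> complex^'n^'n"
  assumes P: "(P has_vector_derivative - (\<i> *k (A ** P x ** pauli3)) - a *k (P x ** pauli1)) (at x)"
    and S: "(S has_vector_derivative P x ** pauli3 ** ctranspose (P x)) (at x)"
    and inv: "invertible (S x)"
    and a: "cnj a = - a"
    and id: "A ** S x - S x ** ctranspose A = \<i> *k (P x ** ctranspose (P x))"
  defines "R \<equiv> ctranspose (P x) ** matrix_inv (S x)"
  shows "((\<lambda>t. ctranspose (P t) ** matrix_inv (S t)) has_vector_derivative
           \<i> *k (pauli3 ** R ** A)
             + (a *k pauli1 + (pauli3 ** (R ** P x) - (R ** P x) ** pauli3)) ** R) (at x)"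
proof -
  define T where "T = matrix_inv (S x)"
  have ST: "S x ** T = mat 1" "T ** S x = mat 1"
    using inv by (simp_all add: T_def matrix_inv_left matrix_inv_right)
  \<comment> \<open>Multiplying by \<open>T\<close> on both sides cancels \<open>S x\<close>; the
    second simplification reassociates to expose \<open>S x ** T\<close>.\<close>
  have "T ** (A ** S x - S x ** ctranspose A) ** T = T ** A - ctranspose A ** T"
    by (simp add: matrix_algebra ST) (simp add: ST flip: matrix_mul_assoc)
  then have TA: "ctranspose A ** T = T ** A - \<i> *k (T ** P x ** ctranspose (P x) ** T)"
    unfolding id by (simp add: matrix_algebra)
  have "((\<lambda>t. ctranspose (P t) ** matrix_inv (S t)) has_vector_derivative
      ctranspose (P x) ** - (T ** (P x ** pauli3 ** ctranspose (P x)) ** T) +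
      ctranspose (- (\<i> *k (A ** P x ** pauli3)) - a *k (P x ** pauli1)) ** T) (at x)"
    unfolding T_def
    by (intro matrix_mult.has_vector_derivative matrix_inv_has_vector_derivative S inv
        bounded_linear.has_vector_derivative [OF bounded_linear_ctranspose P])
  moreover have "ctranspose (- (\<i> *k (A ** P x ** pauli3)) - a *k (P x ** pauli1)) ** T
      = \<i> *k (pauli3 ** ctranspose (P x) ** (ctranspose A ** T)) + a *k (pauli1 ** ctranspose (P x) ** T)"
    by (simp add: ctranspose_diff ctranspose_minus ctranspose_cscale ctranspose_matrix_mult a
        matrix_algebra)
  ultimately show ?thesis
    unfolding TA R_def T_def [symmetric] by (simp add: matrix_algebra algebra_simps)
qed

section \<open>The Dirac-Weyl system and the realness of its potential\<close>

theorem corollary4p2: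
  fixes a :: complex
    and A Q :: "complex^'n^'n"
    and f1 f2 f3 f4 :: "complex^'n"
    and \<Lambda>1 \<Lambda>2 :: "real \<Rightarrow> complex^'n"
    and P :: "real \<Rightarrow> complex^2^'n"
    and S :: "real \<Rightarrow> complex^'n^'n"
    and \<psi> :: "real \<Rightarrow> real \<Rightarrow> complex^'n^2"
    and \<omega> :: "real \<Rightarrow> complex"
  assumes "a \<noteq> 0"
    and "\<i> * a \<in> \<real>"
    and "real_matrix (\<i> *k A)"
    and "real_matrix (\<i> *k Q)"
    and "real_matrix (S 0)"
    and "S 0 = ctranspose (S 0)"
    and "real_vector f1"
    and "real_vector f2"
    and "A ** Q = Q ** A"
    and "Q ** Q = A ** A + complex_of_real ((cmod a)\<^sup>2) *k mat 1"
    and "f3 = ((\<i> / cnj a) *k (Q + A)) *v f1"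
    and "f4 = - (((\<i> / cnj a) *k (Q - A)) *v f2)"
    and "\<And>x. \<Lambda>1 x = mat_exp ((\<i> * complex_of_real x) *k Q) *v f1
                     + mat_exp ((- (\<i> * complex_of_real x)) *k Q) *v f2"
    and "\<And>x. \<Lambda>2 x = mat_exp ((\<i> * complex_of_real x) *k Q) *v f3
                     + mat_exp ((- (\<i> * complex_of_real x)) *k Q) *v f4"
    and "\<And>x. P x = two_columns (\<Lambda>1 x) (\<Lambda>2 x)"
    and "A ** S 0 - S 0 ** ctranspose A = \<i> *k (P 0 ** ctranspose (P 0))"
    and "\<And>x. S x = S 0 + (LBINT r=0..x. P r ** pauli3 ** ctranspose (P r))"
    and "\<And>x \<xi>. \<psi> x \<xi> = ctranspose (P x) ** matrix_inv (S x) ** mat_exp (- (\<xi> *\<^sub>R A))"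
    and "\<And>x. \<omega> x = - \<i> * (a + 2 * cdot (\<Lambda>1 x) (matrix_inv (S x) *v \<Lambda>2 x))"
  shows "\<forall>x. invertible (S x) \<longrightarrow>
           \<omega> x = cnj (\<omega> x) \<and>
           (\<forall>\<xi>. \<exists>\<psi>x \<psi>\<xi>.
              ((\<lambda>t. \<psi> t \<xi>) has_vector_derivative \<psi>x) (at x) \<and>
              ((\<lambda>\<eta>. \<psi> x \<eta>) has_vector_derivative \<psi>\<xi>) (at \<xi>) \<and>
              \<psi>x = (\<i> *k pauli3) ** (- \<psi>\<xi> + (\<i> * \<omega> x) *k (pauli2 ** \<psi> x \<xi>)))"
proof -
  note a_nz = assms(1) and AQ = assms(9) and QQ = assms(10) and f3 = assms(11) and f4 = assms(12)
    and L1 = assms(13) and L2 = assms(14) and P = assms(15) and S0 = assms(16) and S = assms(17)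
    and \<psi> = assms(18) and \<omega> = assms(19)
  have a: "cnj a = - a"
    using assms(2) by (simp add: complex_is_Real_iff complex_eq_iff)
  \<comment> \<open>The scalar in \<open>f3\<close> and \<open>f4\<close>. As \<open>a\<close> is
    purely imaginary, \<open>c * a = - \<i>\<close> and the relation for \<open>Q\<close> reads Q^2
    = A^2 - a^2.\<close>
  define c where "c = \<i> / cnj a"
  have ca: "c * a = - \<i>" and norm_a: "complex_of_real ((cmod a)\<^sup>2) = - (a * a)"
    using a_nz by (simp_all add: c_def a complex_norm_square del: of_real_power)
  have acz: "a * (c * z) = - \<i> * z" for z
    using ca by (metis mult.assoc mult.commute)
  \<comment> \<open>The two exponential parts of \<open>\<Lambda>1\<close>. Since
    \<open>Q + A\<close> and \<open>Q - A\<close> commute with the exponentials of \<open>Q\<close>,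
    they determine \<open>\<Lambda>2\<close> as well.\<close>
  define u where "u x = mat_exp ((\<i> * complex_of_real x) *k Q) *v f1" for x
  define w where "w x = mat_exp ((- (\<i> * complex_of_real x)) *k Q) *v f2" for x
  have QA: "(Q + A) ** Q = Q ** (Q + A)" "(Q - A) ** Q = Q ** (Q - A)"
    by (simp_all add: matrix_algebra AQ)
  have L1': "\<Lambda>1 x = u x + w x" for x
    by (simp add: L1 u_def w_def)
  have exp_comm: "(c *k (Q + A)) ** mat_exp (z *k Q) = mat_exp (z *k Q) ** (c *k (Q + A))"
    "(c *k (Q - A)) ** mat_exp (z *k Q) = mat_exp (z *k Q) ** (c *k (Q - A))" for z
    by (rule mat_exp_commute, simp add: cscale_matrix_mult matrix_mult_cscale QA cscale_cscale mult.commute)+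
  have L2': "\<Lambda>2 x = (c *k (Q + A)) *v u x - (c *k (Q - A)) *v w x" for x
    by (simp add: L2 f3 f4 u_def w_def matrix_vector_mul_assoc exp_comm matrix_vector_mult.minus_right
        flip: c_def)
  have du: "(u has_vector_derivative (\<i> *k Q) *v u x) (at x)" for x
    using bounded_linear.has_vector_derivative [OF matrix_vector_mult.bounded_linear_left
        mat_exp_has_vector_derivative [of "\<i> *k Q" x], of f1]
    by (simp add: u_def [abs_def] cscale_cscale mult.commute matrix_vector_mul_assoc)
  have dw: "(w has_vector_derivative - ((\<i> *k Q) *v w x)) (at x)" for x
    using bounded_linear.has_vector_derivative [OF matrix_vector_mult.bounded_linear_left
        mat_exp_has_vector_derivative [of "- \<i> *k Q" x], of f2]
    by (simp add: w_def [abs_def] cscale_cscale mult.commute matrix_vector_mul_assoc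
        cscale_minus cscale_minus_left matrix_mult.minus_left matrix_vector_mult.minus_left)
  have dL1: "(\<Lambda>1 has_vector_derivative - (\<i> *s (A *v \<Lambda>1 x)) - a *s \<Lambda>2 x) (at x)" for x
  proof -
    have "(\<Lambda>1 has_vector_derivative (\<i> *k Q) *v u x + - ((\<i> *k Q) *v w x)) (at x)"
      unfolding L1' [abs_def] by (intro has_vector_derivative_add du dw)
    \<comment> \<open>By \<open>a * c = - \<i>\<close>, the term \<open>- a *s \<Lambda>2 x\<close>
      equals iQ(u - w) + iA(u + w).\<close>
    moreover have "(\<i> *k Q) *v u x + - ((\<i> *k Q) *v w x) = - (\<i> *s (A *v \<Lambda>1 x)) - a *s \<Lambda>2 x"
      by (simp add: acz L1' L2' cscale_matrix_vector_mult matrix_vector_mult.add_right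
          matrix_vector_mult.add_left matrix_vector_mult.diff_left vec_eq_iff algebra_simps)
    ultimately show ?thesis by simp
  qed
  have dL2: "(\<Lambda>2 has_vector_derivative \<i> *s (A *v \<Lambda>2 x) - a *s \<Lambda>1 x) (at x)" for x
  proof -
    have "(\<Lambda>2 has_vector_derivative
        (c *k (Q + A)) *v ((\<i> *k Q) *v u x) - (c *k (Q - A)) *v (- ((\<i> *k Q) *v w x))) (at x)"
      unfolding L2' [abs_def]
      by (intro has_vector_derivative_diff du dw
          bounded_linear.has_vector_derivative [OF matrix_vector_mult.bounded_linear_right])
    moreover have "(c *k (Q + A)) *v ((\<i> *k Q) *v u x) - (c *k (Q - A)) *v (- ((\<i> *k Q) *v w x))
        = \<i> *s (A *v \<Lambda>2 x) - a *s \<Lambda>1 x"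
    proof -
      \<comment> \<open>The derivative of \<open>\<Lambda>2\<close> exceeds iA
        \<open>\<Lambda>2\<close> by ic(Q^2 - A^2) \<open>\<Lambda>1\<close>, which is -a
        \<open>\<Lambda>1\<close> by this relation.\<close>
      have QQv: "Q *v (Q *v v) = A *v (A *v v) - (a * a) *s v" for v
        by (simp add: matrix_vector_mul_assoc QQ norm_a matrix_vector_mult.add_left
            cscale_matrix_vector_mult vec_eq_iff del: of_real_power)
      have QAv: "Q *v (A *v v) = A *v (Q *v v)" for v
        by (simp add: matrix_vector_mul_assoc AQ)
      show ?thesis
        by (simp add: acz L1' L2' cscale_matrix_vector_mult matrix_vector_mult_scalar QQv QAv
            matrix_vector_mult.add_right matrix_vector_mult.add_left matrix_vector_mult.diff_left
            matrix_vector_mult.diff_right matrix_vector_mult.minus_right vec_eq_iff algebra_simps)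
    qed
    ultimately show ?thesis by simp
  qed
  have dP: "(P has_vector_derivative - (\<i> *k (A ** P x ** pauli3)) - a *k (P x ** pauli1)) (at x)" for x
  proof -
    have "(P has_vector_derivative two_columns (- (\<i> *s (A *v \<Lambda>1 x)) - a *s \<Lambda>2 x)
        (\<i> *s (A *v \<Lambda>2 x) - a *s \<Lambda>1 x)) (at x)"
      unfolding P [abs_def] by (intro two_columns_has_vector_derivative dL1 dL2)
    moreover have "two_columns (- (\<i> *s (A *v \<Lambda>1 x)) - a *s \<Lambda>2 x) (\<i> *s (A *v \<Lambda>2 x) - a *s \<Lambda>1 x)
        = - (\<i> *k (A ** P x ** pauli3)) - a *k (P x ** pauli1)"
      by (simp add: P matrix_mult_two_columns two_columns_mult_pauli vec_eq_iff forall_2)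
    ultimately show ?thesis by simp
  qed
  have cont_P: "continuous_on UNIV P"
    using dP by (meson continuous_at_imp_continuous_on has_vector_derivative_continuous)
  have dS: "(S has_vector_derivative P x ** pauli3 ** ctranspose (P x)) (at x)" for x
  proof -
    have "continuous_on UNIV (\<lambda>r. P r ** pauli3 ** ctranspose (P r))"
      by (intro matrix_mult.continuous_on bounded_linear.continuous_on [OF bounded_linear_ctranspose]
          cont_P continuous_on_const)
    from has_vector_derivative_add [OF has_vector_derivative_const
        interval_integral_has_vector_derivative [OF this], of "S 0" x]
    show ?thesis by (simp flip: S)
  qed
  have dPP: "((\<lambda>t. P t ** ctranspose (P t)) has_vector_derivative
      P x ** ctranspose (- (\<i> *k (A ** P x ** pauli3)) - a *k (P x ** pauli1))
      + (- (\<i> *k (A ** P x ** pauli3)) - a *k (P x ** pauli1)) ** ctranspose (P x)) (at x)" for x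
    by (intro matrix_mult.has_vector_derivative dP
        bounded_linear.has_vector_derivative [OF bounded_linear_ctranspose dP])
  have id: "A ** S x - S x ** ctranspose A = \<i> *k (P x ** ctranspose (P x))" for x
  proof -
    \<comment> \<open>In the derivative of \<open>P t ** ctranspose (P t)\<close> the
      \<open>pauli1\<close> terms cancel because \<open>a\<close> is imaginary; i times the rest is
      AS' - S'A^*.\<close>
    have "((\<lambda>t. A ** S t - S t ** ctranspose A - \<i> *k (P t ** ctranspose (P t)))
        has_vector_derivative 0) (at t)" for t
    proof -
      have "((\<lambda>t. A ** S t - S t ** ctranspose A - \<i> *k (P t ** ctranspose (P t)))
          has_vector_derivative
          A ** (P t ** pauli3 ** ctranspose (P t)) - (P t ** pauli3 ** ctranspose (P t)) ** ctranspose A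
          - \<i> *k (P t ** ctranspose (- (\<i> *k (A ** P t ** pauli3)) - a *k (P t ** pauli1))
            + (- (\<i> *k (A ** P t ** pauli3)) - a *k (P t ** pauli1)) ** ctranspose (P t))) (at t)"
        by (intro has_vector_derivative_diff dS
            bounded_linear.has_vector_derivative [OF matrix_mult.bounded_linear_right]
            bounded_linear.has_vector_derivative [OF matrix_mult.bounded_linear_left]
            bounded_linear.has_vector_derivative [OF bounded_linear_cscale dPP])
      then show ?thesis
        by (simp add: matrix_algebra ctranspose_diff ctranspose_minus ctranspose_cscale
            ctranspose_matrix_mult a)
    qed
    from has_vector_derivative_zero_imp_eq [OF this, of x 0] show ?thesis
      using S0 by simp
  qed
  have herm: "ctranspose (S x) = S x" for x
  proof -
    have "((\<lambda>t. ctranspose (S t) - S t) has_vector_derivative 0) (at t)" for t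
      using has_vector_derivative_diff [OF
          bounded_linear.has_vector_derivative [OF bounded_linear_ctranspose dS [of t]] dS [of t]]
      by (simp add: ctranspose_matrix_mult ctranspose_ctranspose matrix_mul_assoc)
    from has_vector_derivative_zero_imp_eq [OF this, of x 0] show ?thesis
      using assms(6) by simp
  qed
  have c_real: "c \<in> \<real>"
  proof -
    have "c = 1 / (\<i> * a)"
      using a_nz by (simp add: c_def a field_simps)
    with assms(2) show ?thesis by simp
  qed
  have real_Q: "real_matrix ((\<i> * complex_of_real x) *k Q)" for x
    using assms(4) by (simp add: real_matrix_def mult.assoc mult.left_commute [of \<i>])
  have real_E: "real_matrix (mat_exp ((\<i> * complex_of_real x) *k Q))"
    "real_matrix (mat_exp (- (\<i> * complex_of_real x) *k Q))" for x
    using real_matrix_mat_exp real_Q [of x] real_Q [of "- x"] by simp_all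
  have real_f: "real_vector (\<i> *s f3)" "real_vector (\<i> *s f4)"
  proof -
    \<comment> \<open>Attaching the factor i to \<open>Q\<close> and \<open>A\<close> leaves a real
      scalar, a real matrix and a real vector.\<close>
    have "\<i> *s f3 = c *s ((\<i> *k Q + \<i> *k A) *v f1)" "\<i> *s f4 = c *s ((\<i> *k A - \<i> *k Q) *v f2)"
      by (simp_all add: f3 f4 cscale_matrix_vector_mult matrix_vector_mult.add_left
          matrix_vector_mult.diff_left vec_eq_iff algebra_simps flip: c_def)
    moreover have "real_matrix (\<i> *k Q + \<i> *k A)" "real_matrix (\<i> *k A - \<i> *k Q)"
      using assms(3,4) by (simp_all add: real_matrix_def)
    then have "real_vector ((\<i> *k Q + \<i> *k A) *v f1)" "real_vector ((\<i> *k A - \<i> *k Q) *v f2)"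
      using assms(7,8) by (simp_all add: real_matrix_vector_mult)
    ultimately show "real_vector (\<i> *s f3)" "real_vector (\<i> *s f4)"
      using c_real by (simp_all add: real_vector_def)
  qed
  have real_L1: "real_vector (\<Lambda>1 x)" for x
    using real_matrix_vector_mult [OF real_E(1) assms(7)] real_matrix_vector_mult [OF real_E(2) assms(8)]
    by (simp add: L1 real_vector_def)
  have imag_L2: "real_vector (\<i> *s \<Lambda>2 x)" for x
    using real_matrix_vector_mult [OF real_E(1) real_f(1)] real_matrix_vector_mult [OF real_E(2) real_f(2)]
    by (simp add: L2 real_vector_def matrix_vector_mult_scalar distrib_left)
  have real_S: "real_matrix (S x)" for x
  proof -
    have "Im ((P t ** pauli3 ** ctranspose (P t)) $ i $ j) = 0" for t i j
    proof -
      \<comment> \<open>Replacing \<open>\<Lambda>2\<close> by its real multiple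
        \<open>\<i> *s \<Lambda>2 t\<close> does not change the product, as i has modulus 1. So S'
        is real and the imaginary parts of \<open>S\<close> stay constant.\<close>
      have "(P t ** pauli3 ** ctranspose (P t)) $ i $ j
          = \<Lambda>1 t $ i * cnj (\<Lambda>1 t $ j) - (\<i> * \<Lambda>2 t $ i) * cnj (\<i> * \<Lambda>2 t $ j)"
        by (simp add: P two_columns_mult_pauli) (simp add: matrix_matrix_mult_def sum_2 algebra_simps)
      also have "\<dots> = \<Lambda>1 t $ i * \<Lambda>1 t $ j - (\<i> * \<Lambda>2 t $ i) * (\<i> * \<Lambda>2 t $ j)"
        using real_L1 [of t] imag_L2 [of t]
        by (simp only: real_vector_def Reals_cnj_iff vector_smult_component)
      also have "\<dots> \<in> \<real>"
        by (rule Reals_diff; rule Reals_mult)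
          (use real_L1 [of t] imag_L2 [of t] in \<open>simp_all only: real_vector_def vector_smult_component\<close>)
      finally show ?thesis by (simp add: complex_is_Real_iff)
    qed
    moreover have "((\<lambda>t. Im (S t $ i $ j)) has_vector_derivative
        Im ((P t ** pauli3 ** ctranspose (P t)) $ i $ j)) (at t)" for t i j
      by (intro bounded_linear.has_vector_derivative [OF bounded_linear_Im]
          bounded_linear.has_vector_derivative [OF bounded_linear_vec_nth] dS)
    ultimately have "((\<lambda>t. Im (S t $ i $ j)) has_vector_derivative 0) (at t)" for t i j
      by (simp only:)
    from has_vector_derivative_zero_imp_eq [OF this, of x _ _ 0]
    have "Im (S x $ i $ j) = Im (S 0 $ i $ j)" for i j .
    then show ?thesis
      using assms(5) by (simp add: real_matrix_def complex_is_Real_iff)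
  qed
  show ?thesis
  proof (intro allI impI)
    fix x assume inv: "invertible (S x)"
    define T where "T = matrix_inv (S x)"
    define R where "R = ctranspose (P x) ** T"
    define y where "y = cdot (\<Lambda>1 x) (T *v \<Lambda>2 x)"
    have iy: "\<i> * y \<in> \<real>"
    proof -
      have "real_vector (T *v (\<i> *s \<Lambda>2 x))"
        unfolding T_def by (intro real_matrix_vector_mult real_matrix_matrix_inv inv real_S imag_L2)
      moreover have "\<i> * y = cdot (\<Lambda>1 x) (T *v (\<i> *s \<Lambda>2 x))"
        by (simp add: y_def cdot_def matrix_vector_mult_scalar sum_distrib_left mult_ac)
      ultimately show ?thesis
        using real_L1 [of x] by (simp add: cdot_in_Reals)
    qed
    then have y: "cnj y = - y"
      by (simp add: complex_is_Real_iff complex_eq_iff)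
    \<comment> \<open>This is the total coefficient of \<open>pauli1\<close>: \<open>a\<close> from
      P', and \<open>2 * y\<close> from the commutator.\<close>
    have i\<omega>: "\<i> * \<omega> x = a + 2 * y"
      by (simp add: \<omega> y_def T_def flip: mult.assoc)
    have X12: "(R ** P x) $ 1 $ 2 = y"
    proof -
      have "(ctranspose (P x) ** (T ** P x)) $ 1 $ 2 = y"
        by (simp add: P matrix_mult_two_columns y_def cdot_def) (simp add: matrix_vector_mult_def)
      then show ?thesis
        by (simp add: R_def matrix_mul_assoc)
    qed
    \<comment> \<open>Hermitian symmetry makes the (2,1) entry of \<open>R ** P x\<close> the
      conjugate of \<open>y\<close>, hence \<open>- y\<close>, as \<open>pauli3_commutator\<close>
      requires.\<close>
    have "ctranspose T = T"
      using ctranspose_matrix_inv [OF inv] herm by (simp add: T_def)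
    then have "ctranspose (R ** P x) = R ** P x"
      by (simp add: R_def ctranspose_matrix_mult ctranspose_ctranspose matrix_mul_assoc)
    then have "(R ** P x) $ 2 $ 1 = - (R ** P x) $ 1 $ 2"
      using X12 y ctranspose_nth [of "R ** P x" 2 1] by simp
    note X = pauli3_commutator [OF this, unfolded X12]
    have dR: "((\<lambda>t. ctranspose (P t) ** matrix_inv (S t)) has_vector_derivative
        \<i> *k (pauli3 ** R ** A) + (\<i> * \<omega> x) *k (pauli1 ** R)) (at x)"
    proof -
      have "(a *k pauli1 + (2 * y) *k pauli1) ** R = (\<i> * \<omega> x) *k (pauli1 ** R)"
        unfolding i\<omega> by (simp add: matrix_algebra vec_eq_iff algebra_simps)
      with darboux_has_vector_derivative [OF dP dS inv a id] show ?thesis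
        unfolding T_def [symmetric] R_def [symmetric] X by simp
    qed
    show "\<omega> x = cnj (\<omega> x) \<and>
           (\<forall>\<xi>. \<exists>\<psi>x \<psi>\<xi>.
              ((\<lambda>t. \<psi> t \<xi>) has_vector_derivative \<psi>x) (at x) \<and>
              ((\<lambda>\<eta>. \<psi> x \<eta>) has_vector_derivative \<psi>\<xi>) (at \<xi>) \<and>
              \<psi>x = (\<i> *k pauli3) ** (- \<psi>\<xi> + (\<i> * \<omega> x) *k (pauli2 ** \<psi> x \<xi>)))"
    proof (intro conjI allI exI)
      show "\<omega> x = cnj (\<omega> x)"
        using a y by (simp add: \<omega> algebra_simps flip: T_def y_def)
    next
      fix \<xi>
      define E where "E = mat_exp (- (\<xi> *\<^sub>R A))"
      \<comment> \<open>Recasts the real scaling as a complex one, so that the derivative of the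
        exponential applies with \<open>- A\<close>.\<close>
      have E: "mat_exp (- (\<eta> *\<^sub>R A)) = mat_exp (complex_of_real \<eta> *k (- A))" for \<eta>
        by (rule arg_cong [where f = mat_exp]) (simp add: vec_eq_iff scaleR_conv_of_real [where 'a = complex])
      show "((\<lambda>t. \<psi> t \<xi>) has_vector_derivative
          (\<i> *k (pauli3 ** R ** A) + (\<i> * \<omega> x) *k (pauli1 ** R)) ** E) (at x)"
        unfolding \<psi> E_def [symmetric]
        by (rule bounded_linear.has_vector_derivative [OF matrix_mult.bounded_linear_left dR])
      show "((\<lambda>\<eta>. \<psi> x \<eta>) has_vector_derivative R ** (- A ** E)) (at \<xi>)"
        unfolding \<psi> E_def E R_def T_def
        by (rule bounded_linear.has_vector_derivative [OF matrix_mult.bounded_linear_right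
              mat_exp_has_vector_derivative])
      have "\<psi> x \<xi> = R ** E"
        by (simp add: \<psi> R_def T_def E_def)
      \<comment> \<open>The \<xi>-derivative -RAE yields the first term on the left; the second
        follows from \<open>pauli3 ** pauli2 = - \<i> *k pauli1\<close>.\<close>
      then show "(\<i> *k (pauli3 ** R ** A) + (\<i> * \<omega> x) *k (pauli1 ** R)) ** E
          = (\<i> *k pauli3) ** (- (R ** (- A ** E)) + (\<i> * \<omega> x) *k (pauli2 ** \<psi> x \<xi>))"
        by (simp add: matrix_algebra pauli3_mult_pauli2)
    qed
  qed
qed

end
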